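(* Let $(A,\dashv_A,\vdash_A,\alpha_A,\beta_A)$ and $(B,\dashv_B,\vdash_B,\alpha_B,\beta_B)$ be two BiHom-associative dialgebras. Then $(A\oplus B,\triangleleft,\triangleright,\alpha,\beta)$ is a BiHom-associative dialgebra, where for $a,a_1,a_2\in A$ and $b,b_1,b_2\in B$ $$(a_1+b_1)\triangleleft(a_2+b_2)=a_1\dashv_A a_2+b_1\dashv_B b_2,\qquad (a_1+b_1)\triangleright(a_2+b_2)=a_1\vdash_A a_2+b_1\vdash_B b_2,$$ $$\alpha(a+b)=\alpha_A(a)+\alpha_B(b),\qquad \beta(a+b)=\beta_A(a)+\beta_B(b).$$ Moreover, if $\xi:A\to B$ is a linear map, then $\xi$ is a morphism of BiHom-associative dialgebras from $(A,\dashv_A,\vdash_A,\alpha_A,\beta_A)$ to $(B,\dashv_B,\vdash_B,\alpha_B,\beta_B)$ if and only if its graph $\Gamma_\xi=\{(x,\xi(x)):x\in A\}$ is a BiHom-subalgebra of $(A\oplus B,\triangleleft,\triangleright,\alpha,\beta)$.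
   Context: All vector spaces are over a fixed field. A BiHom-associative dialgebra is a tuple $(A,\dashv,\vdash,\alpha,\beta)$ consisting of a vector space $A$, bilinear maps $\dashv,\vdash:A\times A\to A$ and linear maps $\alpha,\beta:A\to A$ such that $\alpha\circ\beta=\beta\circ\alpha$ and, for all $x,y,z\in A$: (i) $(x\dashv y)\dashv\beta(z)=\alpha(x)\dashv(y\dashv z)$; (ii) $(x\dashv y)\dashv\beta(z)=\alpha(x)\dashv(y\vdash z)$; (iii) $(x\vdash y)\dashv\beta(z)=\alpha(x)\vdash(y\dashv z)$; (iv) $(x\dashv y)\vdash\beta(z)=\alpha(x)\vdash(y\vdash z)$; (v) $(x\vdash y)\vdash\beta(z)=\alpha(x)\vdash(y\vdash z)$. A morphism of BiHom-associative dialgebras is a linear map commuting with the structure maps ($\alpha'\circ f=f\circ\alpha$, $\beta'\circ f=f\circ\beta$) and preserving both products. A BiHom-subalgebra of $(D,\dashv,\vdash,\alpha,\beta)$ is a subset $D_0\subseteq D$ stable under $\alpha$ and $\beta$ with $x\dashv y,\ x\vdash y\in D_0$ for all $x,y\in D_0$. The element $(a,b)$ of $A\oplus B$ is also written $a+b$. *)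

theory Defs
  imports "HOL-Analysis.Product_Vector"
begin

locale bihom_assoc_dialgebra = vector_space scale
  for scale :: "'k::field \<Rightarrow> 'a::ab_group_add \<Rightarrow> 'a" +
  fixes left_prod :: "'a \<Rightarrow> 'a \<Rightarrow> 'a" (infixl \<open>\<stileturn>\<close> 70)
    and right_prod :: "'a \<Rightarrow> 'a \<Rightarrow> 'a" (infixl \<open>\<turnstile>\<close> 70)
    and \<alpha> :: "'a \<Rightarrow> 'a"
    and \<beta> :: "'a \<Rightarrow> 'a"
  assumes linear_left_prod1: "\<And>y. Vector_Spaces.linear scale scale (\<lambda>x. x \<stileturn> y)"
    and linear_left_prod2: "\<And>x. Vector_Spaces.linear scale scale (\<lambda>y. x \<stileturn> y)"
    and linear_right_prod1: "\<And>y. Vector_Spaces.linear scale scale (\<lambda>x. x \<turnstile> y)"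
    and linear_right_prod2: "\<And>x. Vector_Spaces.linear scale scale (\<lambda>y. x \<turnstile> y)"
    and linear_alpha: "Vector_Spaces.linear scale scale \<alpha>"
    and linear_beta: "Vector_Spaces.linear scale scale \<beta>"
    and alpha_beta_commute: "\<alpha> \<circ> \<beta> = \<beta> \<circ> \<alpha>"
    and assoc_i: "\<And>x y z. (x \<stileturn> y) \<stileturn> \<beta> z = \<alpha> x \<stileturn> (y \<stileturn> z)"
    and assoc_ii: "\<And>x y z. (x \<stileturn> y) \<stileturn> \<beta> z = \<alpha> x \<stileturn> (y \<turnstile> z)"
    and assoc_iii: "\<And>x y z. (x \<turnstile> y) \<stileturn> \<beta> z = \<alpha> x \<turnstile> (y \<stileturn> z)"
    and assoc_iv: "\<And>x y z. (x \<stileturn> y) \<turnstile> \<beta> z = \<alpha> x \<turnstile> (y \<turnstile> z)"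
    and assoc_v: "\<And>x y z. (x \<turnstile> y) \<turnstile> \<beta> z = \<alpha> x \<turnstile> (y \<turnstile> z)"

locale bihom_assoc_dialgebra_morphism =
  A: bihom_assoc_dialgebra sA lA rA \<alpha>A \<beta>A +
  B: bihom_assoc_dialgebra sB lB rB \<alpha>B \<beta>B +
  Vector_Spaces.linear sA sB f
  for sA :: "'k::field \<Rightarrow> 'a::ab_group_add \<Rightarrow> 'a" and lA rA \<alpha>A \<beta>A
    and sB :: "'k \<Rightarrow> 'b::ab_group_add \<Rightarrow> 'b" and lB rB \<alpha>B \<beta>B
    and f :: "'a \<Rightarrow> 'b" +
  assumes comp_alpha: "\<alpha>B \<circ> f = f \<circ> \<alpha>A"
    and comp_beta: "\<beta>B \<circ> f = f \<circ> \<beta>A"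
    and map_left_prod: "\<And>x y. f (lA x y) = lB (f x) (f y)"
    and map_right_prod: "\<And>x y. f (rA x y) = rB (f x) (f y)"

text \<open>A BiHom-subalgebra is only required to be a subset closed under the operations,
  not a linear subspace.\<close>

locale bihom_subalgebra = bihom_assoc_dialgebra scale left_prod right_prod \<alpha> \<beta>
  for scale :: "'k::field \<Rightarrow> 'a::ab_group_add \<Rightarrow> 'a"
    and left_prod (infixl \<open>\<stileturn>\<close> 70) and right_prod (infixl \<open>\<turnstile>\<close> 70) and \<alpha> \<beta> +
  fixes D :: "'a set"
  assumes alpha_closed: "\<And>x. x \<in> D \<Longrightarrow> \<alpha> x \<in> D"
    and beta_closed: "\<And>x. x \<in> D \<Longrightarrow> \<beta> x \<in> D"
    and left_prod_closed: "\<And>x y. x \<in> D \<Longrightarrow> y \<in> D \<Longrightarrow> x \<stileturn> y \<in> D"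
    and right_prod_closed: "\<And>x y. x \<in> D \<Longrightarrow> y \<in> D \<Longrightarrow> x \<turnstile> y \<in> D"

text \<open>The direct sum of two vector spaces is carried by the product type, with the library's
  componentwise addition and scalar multiplication \<^const>\<open>module_prod.scale\<close>; the
  componentwise linear map is \<^const>\<open>map_prod\<close>.\<close>

fun direct_sum_mult ::
  "('a \<Rightarrow> 'a \<Rightarrow> 'a) \<Rightarrow> ('b \<Rightarrow> 'b \<Rightarrow> 'b) \<Rightarrow> 'a \<times> 'b \<Rightarrow> 'a \<times> 'b \<Rightarrow> 'a \<times> 'b" where
  "direct_sum_mult mA mB (a1, b1) (a2, b2) = (mA a1 a2, mB b1 b2)"

end

theory Submission
  imports Defs
begin

text \<open>Every operation of the direct sum acts componentwise, so each axiom holds in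
  \<open>A \<oplus> B\<close> because it holds in both components. For the graph, closure under an
  operation says, read componentwise, that an image of graph points under that operation has
  second component \<open>\<xi>\<close> of its first component; this is exactly the equation that
  \<open>\<xi>\<close> preserves the operation. Hence the four closure conditions on \<open>\<Gamma>\<^sub>\<xi>\<close>
  are, one by one, the four conditions on a morphism.\<close>

lemma direct_sum_mult_eq:
  "direct_sum_mult mA mB p q = (mA (fst p) (fst q), mB (snd p) (snd q))"
  by (cases p; cases q) simp

lemma linear_componentwise:
  assumes "Vector_Spaces.linear sA sA' f" and "Vector_Spaces.linear sB sB' g"
  shows "Vector_Spaces.linear (module_prod.scale sA sB) (module_prod.scale sA' sB')
    (\<lambda>p. (f (fst p), g (snd p)))"
proof -
  interpret f: Vector_Spaces.linear sA sA' f by fact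
  interpret g: Vector_Spaces.linear sB sB' g by fact
  interpret dom: vector_space_prod sA sB by unfold_locales
  interpret cod: vector_space_prod sA' sB' by unfold_locales
  show ?thesis
    by unfold_locales
      (simp_all add: dom.scale_def cod.scale_def f.add g.add f.scale g.scale)
qed

lemma bihom_assoc_dialgebra_direct_sum:
  assumes "bihom_assoc_dialgebra sA lA rA \<alpha>A \<beta>A"
    and "bihom_assoc_dialgebra sB lB rB \<alpha>B \<beta>B"
  shows "bihom_assoc_dialgebra (module_prod.scale sA sB)
    (direct_sum_mult lA lB) (direct_sum_mult rA rB) (map_prod \<alpha>A \<alpha>B) (map_prod \<beta>A \<beta>B)"
proof -
  interpret A: bihom_assoc_dialgebra sA lA rA \<alpha>A \<beta>A by fact
  interpret B: bihom_assoc_dialgebra sB lB rB \<alpha>B \<beta>B by fact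
  interpret vector_space_prod sA sB by unfold_locales
  note componentwise = direct_sum_mult_eq map_prod_def case_prod_beta fst_conv snd_conv
  show ?thesis
  proof (intro bihom_assoc_dialgebra.intro p.vector_space_axioms
      bihom_assoc_dialgebra_axioms.intro)
    show "map_prod \<alpha>A \<alpha>B \<circ> map_prod \<beta>A \<beta>B = map_prod \<beta>A \<beta>B \<circ> map_prod \<alpha>A \<alpha>B"
      by (simp only: map_prod_compose[symmetric] A.alpha_beta_commute B.alpha_beta_commute)
  qed (unfold componentwise,
      (rule linear_componentwise A.linear_left_prod1 A.linear_left_prod2
        A.linear_right_prod1 A.linear_right_prod2 A.linear_alpha A.linear_beta
        B.linear_left_prod1 B.linear_left_prod2 B.linear_right_prod1 B.linear_right_prod2
        B.linear_alpha B.linear_beta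
      | rule arg_cong2[where f = Pair] A.assoc_i A.assoc_ii A.assoc_iii A.assoc_iv A.assoc_v
        B.assoc_i B.assoc_ii B.assoc_iii B.assoc_iv B.assoc_v)+)
qed

lemma graph_closed_map_prod_iff:
  "(\<forall>p \<in> {(x, f x) | x. True}. map_prod u v p \<in> {(x, f x) | x. True}) \<longleftrightarrow> v \<circ> f = f \<circ> u"
  by (auto simp: fun_eq_iff)

lemma graph_closed_direct_sum_mult_iff:
  "(\<forall>p \<in> {(x, f x) | x. True}. \<forall>q \<in> {(x, f x) | x. True}.
      direct_sum_mult mA mB p q \<in> {(x, f x) | x. True}) \<longleftrightarrow>
    (\<forall>x y. f (mA x y) = mB (f x) (f y))"
  by (auto simp: direct_sum_mult_eq)

theorem proposition2p29:
  fixes sA :: "'k::field \<Rightarrow> 'a::ab_group_add \<Rightarrow> 'a"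
    and sB :: "'k \<Rightarrow> 'b::ab_group_add \<Rightarrow> 'b"
    and lA rA :: "'a \<Rightarrow> 'a \<Rightarrow> 'a" and \<alpha>A \<beta>A :: "'a \<Rightarrow> 'a"
    and lB rB :: "'b \<Rightarrow> 'b \<Rightarrow> 'b" and \<alpha>B \<beta>B :: "'b \<Rightarrow> 'b"
  assumes "bihom_assoc_dialgebra sA lA rA \<alpha>A \<beta>A"
    and "bihom_assoc_dialgebra sB lB rB \<alpha>B \<beta>B"
  shows "bihom_assoc_dialgebra (module_prod.scale sA sB)
           (direct_sum_mult lA lB) (direct_sum_mult rA rB) (map_prod \<alpha>A \<alpha>B) (map_prod \<beta>A \<beta>B)
       \<and> (\<forall>\<xi>. Vector_Spaces.linear sA sB \<xi> \<longrightarrow>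
           (bihom_assoc_dialgebra_morphism sA lA rA \<alpha>A \<beta>A sB lB rB \<alpha>B \<beta>B \<xi> \<longleftrightarrow>
            bihom_subalgebra (module_prod.scale sA sB)
              (direct_sum_mult lA lB) (direct_sum_mult rA rB) (map_prod \<alpha>A \<alpha>B) (map_prod \<beta>A \<beta>B)
              {(x, \<xi> x) | x. True}))"
proof (intro conjI allI impI)
  show sum: "bihom_assoc_dialgebra (module_prod.scale sA sB)
      (direct_sum_mult lA lB) (direct_sum_mult rA rB) (map_prod \<alpha>A \<alpha>B) (map_prod \<beta>A \<beta>B)"
    using assms by (rule bihom_assoc_dialgebra_direct_sum)
  fix \<xi> assume lin: "Vector_Spaces.linear sA sB \<xi>"
  let ?G = "{(x, \<xi> x) | x. True}"
  have "bihom_subalgebra (module_prod.scale sA sB)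
      (direct_sum_mult lA lB) (direct_sum_mult rA rB) (map_prod \<alpha>A \<alpha>B) (map_prod \<beta>A \<beta>B) ?G
    \<longleftrightarrow> (\<forall>p\<in>?G. map_prod \<alpha>A \<alpha>B p \<in> ?G) \<and> (\<forall>p\<in>?G. map_prod \<beta>A \<beta>B p \<in> ?G)
      \<and> (\<forall>p\<in>?G. \<forall>q\<in>?G. direct_sum_mult lA lB p q \<in> ?G)
      \<and> (\<forall>p\<in>?G. \<forall>q\<in>?G. direct_sum_mult rA rB p q \<in> ?G)"
    unfolding bihom_subalgebra_def bihom_subalgebra_axioms_def using sum by blast
  also have "\<dots> \<longleftrightarrow> \<alpha>B \<circ> \<xi> = \<xi> \<circ> \<alpha>A \<and> \<beta>B \<circ> \<xi> = \<xi> \<circ> \<beta>A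
      \<and> (\<forall>x y. \<xi> (lA x y) = lB (\<xi> x) (\<xi> y)) \<and> (\<forall>x y. \<xi> (rA x y) = rB (\<xi> x) (\<xi> y))"
    by (simp only: graph_closed_map_prod_iff graph_closed_direct_sum_mult_iff)
  also have "\<dots> \<longleftrightarrow> bihom_assoc_dialgebra_morphism sA lA rA \<alpha>A \<beta>A sB lB rB \<alpha>B \<beta>B \<xi>"
    unfolding bihom_assoc_dialgebra_morphism_def bihom_assoc_dialgebra_morphism_axioms_def
    using assms lin by blast
  finally show "bihom_assoc_dialgebra_morphism sA lA rA \<alpha>A \<beta>A sB lB rB \<alpha>B \<beta>B \<xi> \<longleftrightarrow>
      bihom_subalgebra (module_prod.scale sA sB)
        (direct_sum_mult lA lB) (direct_sum_mult rA rB) (map_prod \<alpha>A \<alpha>B) (map_prod \<beta>A \<beta>B) ?G"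
    by (rule sym)
qed

end
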